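(* Let $n\ge 1$ and let $\mathbb{U}^n=\{z\in\mathbb{C}^n:\|z\|<1\}$ be the unit polydisk, where $\|z\|=\max_{1\le j\le n}|z_j|$. Let $f:\mathbb{U}^n\to\mathbb{C}$ be holomorphic with $f(0)=1$, and suppose that the mapping $F:\mathbb{U}^n\to\mathbb{C}^n$, $F(z)=zf(z)=f(z)\,z$, belongs to $\mathcal{S}^*(\mathbb{U}^n)$. Then $$\left\|\frac{1}{3!}D^3F(0)\left(z^2,\frac{D^3F(0)(z^3)}{3!}\right)-\frac{D^5F(0)(z^5)}{5!}\right\|\le 4\|z\|^5,\qquad z\in\mathbb{U}^n .$$ The inequality is sharp: for every $n\ge 1$ there exist a holomorphic $f:\mathbb{U}^n\to\mathbb{C}$ with $f(0)=1$ and $F(z)=zf(z)\in\mathcal{S}^*(\mathbb{U}^n)$, and a point $z\in\mathbb{U}^n\setminus\{0\}$, for which equality holds.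
   Context: For a holomorphic mapping $F:\mathbb{U}^n\to\mathbb{C}^n$, $D^mF(0)$ denotes the $m$-th Fréchet derivative of $F$ at $0$, a symmetric $m$-linear mapping $(\mathbb{C}^n)^m\to\mathbb{C}^n$. Write $D^mF(0)(z^m)=D^mF(0)(z,\dots,z)$ ($m$ copies of $z$) and $D^3F(0)(z^2,w)=D^3F(0)(z,z,w)$. The norm on $\mathbb{C}^n$ is the maximum norm $\|z\|=\max_{1\le j\le n}|z_j|$. A holomorphic mapping $F:\mathbb{U}^n\to\mathbb{C}^n$ is normalized if $F(0)=0$ and $DF(0)=I$ (the identity), and locally biholomorphic if $DF(z)$ is invertible for each $z\in\mathbb{U}^n$. The class $\mathcal{S}^*(\mathbb{U}^n)$ of starlike mappings on $\mathbb{U}^n$ consists of all normalized locally biholomorphic mappings $F:\mathbb{U}^n\to\mathbb{C}^n$ such that, writing $q(z)=(q_1(z),\dots,q_n(z))'=[DF(z)]^{-1}F(z)$, one has $\operatorname{Re}\big(q_k(z)/z_k\big)>0$ for all $z\in\mathbb{U}^n\setminus\{0\}$ and every index $k$ satisfying $|z_k|=\|z\|=\max_{1\le j\le n}|z_j|$. *)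

theory Defs
  imports "HOL-Analysis.Analysis"
begin

text \<open>The library norm on \<^typ>\<open>complex^'n\<close> is the Euclidean one, and \<^const>\<open>infnorm\<close> takes the
  maximum over the real coordinates; neither is the maximum of the moduli of the components.\<close>

definition maxnorm :: "complex^'n \<Rightarrow> real" where
  "maxnorm z = Max (range (\<lambda>j. cmod (z $ j)))"

definition polydisk :: "(complex^'n) set" where
  "polydisk = {z. maxnorm z < 1}"

text \<open>The relation \<^const>\<open>has_derivative\<close> only asks for a real-linear derivative, so complex
  linearity is required separately.\<close>

definition holomorphic_fun_on :: "(complex^'n \<Rightarrow> complex) \<Rightarrow> (complex^'n) set \<Rightarrow> bool" where
  "holomorphic_fun_on f S \<longleftrightarrow>
     open S \<and> (\<forall>z\<in>S. \<exists>L. (f has_derivative L) (at z) \<and> Vector_Spaces.linear (*s) (*) L)"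

definition holomorphic_map_on :: "(complex^'n \<Rightarrow> complex^'m) \<Rightarrow> (complex^'n) set \<Rightarrow> bool" where
  "holomorphic_map_on F S \<longleftrightarrow>
     open S \<and> (\<forall>z\<in>S. \<exists>L. (F has_derivative L) (at z) \<and> Vector_Spaces.linear (*s) (*s) L)"

text \<open>The value \<open>D\<^sup>mF(z)(v\<^sub>1,\<dots>,v\<^sub>m)\<close> of the \<open>m\<close>-th Frechet derivative is
  \<open>Dn F [v\<^sub>1,\<dots>,v\<^sub>m] z\<close>: the derivative of \<open>D\<^sup>m\<^sup>-\<^sup>1F\<close> at \<open>z\<close>, applied
  to \<open>v\<^sub>1\<close> and then to the remaining arguments. The latter evaluation is continuous and linear,
  hence may be carried out before differentiating.\<close>

fun Dn :: "('a::real_normed_vector \<Rightarrow> 'b::real_normed_vector) \<Rightarrow> 'a list \<Rightarrow> 'a \<Rightarrow> 'b" where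
  "Dn F [] z = F z"
| "Dn F (v # vs) z = frechet_derivative (Dn F vs) (at z) v"

definition normalized :: "(complex^'n \<Rightarrow> complex^'n) \<Rightarrow> bool" where
  "normalized F \<longleftrightarrow> F 0 = 0 \<and> frechet_derivative F (at 0) = id"

definition locally_biholomorphic :: "(complex^'n \<Rightarrow> complex^'n) \<Rightarrow> bool" where
  "locally_biholomorphic F \<longleftrightarrow> (\<forall>z\<in>polydisk. bij (frechet_derivative F (at z)))"

definition starlike_maps :: "(complex^'n \<Rightarrow> complex^'n) set" where
  "starlike_maps = {F. holomorphic_map_on F polydisk \<and> normalized F \<and> locally_biholomorphic F \<and>
     (\<forall>z\<in>polydisk - {0}. \<forall>k. cmod (z $ k) = maxnorm z \<longrightarrow>
        Re (inv (frechet_derivative F (at z)) (F z) $ k / z $ k) > 0)}"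

end

theory Submission
  imports Defs "HOL-Complex_Analysis.Complex_Analysis"
begin

text \<open>For a map of the form \<open>F(z) = f(z) z\<close> the operator \<open>DF(z)\<close> acts on the line through \<open>z\<close> as multiplication
by \<open>d(z) = f(z) + Df(z)z\<close>, so \<open>[DF(z)]\<inverse> F(z) = (f(z)/d(z)) z\<close> and a normalized locally biholomorphic
\<open>F\<close> of this form is starlike exactly when \<open>Re (f(z)/d(z)) > 0\<close> for \<open>z \<noteq> 0\<close>.
Everything therefore happens on complex lines through the origin. Fix \<open>u\<close> on the unit sphere of the maximum
norm and put \<open>h(s) = f(su) = \<Sum> h\<^sub>m s\<^sup>m\<close>; then \<open>s h(s)\<close> is a starlike function of one variable.

The left-hand side of the inequality only sees \<open>h\<close>: the \<open>m\<close>-th derivative of \<open>F\<close> along \<open>z\<close> is a coefficient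
of \<open>s \<mapsto> F(sz)\<close>, and the inner vector \<open>D\<^sup>3F(0)(z\<^sup>3)/3!\<close> is a complex multiple of \<open>z\<close>, which complex
linearity pulls out. The expression equals \<open>(h\<^sub>2\<^sup>2 - h\<^sub>4) z\<close>
(\<open>Dn_scalar_multiple_zalcman\<close>), where \<open>h\<close> is now taken along \<open>z\<close>, and one has to show
\<open>\<bar>h\<^sub>2\<^sup>2 - h\<^sub>4\<bar> \<le> 4\<close> along unit vectors. This is the Zalcman inequality for the third and fifth coefficients
of a starlike function.

Let \<open>p = h'/(2h + s h')\<close>. Then \<open>s p(s)\<close> is the Cayley transform of \<open>f/d\<close>, so it maps the disk into
itself, and \<open>\<bar>p\<bar> \<le> 1\<close> by the Schwarz lemma. Reading \<open>h' = p (2h + s h')\<close> as a recursion for the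
coefficients gives
\<open>h\<^sub>2\<^sup>2 - h\<^sub>4 = 4p\<^sub>0\<^sup>4 - (7/6) p\<^sub>0\<^sup>2 p\<^sub>1 - (7/3) p\<^sub>0 p\<^sub>2 - (1/2) p\<^sub>3\<close>.
As \<open>\<bar>p\<^sub>k\<bar> \<le> 1 - \<bar>p\<^sub>0\<bar>\<^sup>2\<close> for \<open>k \<ge> 1\<close> (\<open>fps_nth_le_1_minus_square\<close>), what remains is a polynomial
inequality in the real number \<open>\<bar>p\<^sub>0\<bar>\<close>.

The higher derivatives exist because directional derivatives of a complex differentiable function are again
complex differentiable (\<open>holomorphic_fun_on_directional_derivative\<close>), which follows from
Cauchy's formula on a line by differentiating under the integral sign.

Equality holds for \<open>f(z) = 1/(1 - z\<^sub>k)\<^sup>2\<close> at a point with equal coordinates: there \<open>p\<close> is constant,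
and only the term \<open>4p\<^sub>0\<^sup>4\<close> survives.\<close>

section \<open>Coefficients of bounded holomorphic functions\<close>

text \<open>Cauchy's estimate needs continuity on a closed disk, so it is applied on radii below \<open>1\<close>; the radius is
the \<open>n\<close>-th root of \<open>s\<close>, which turns its loss into the factor \<open>s\<close>.\<close>

lemma bounded_holomorphic_fps_nth_le_1:
  assumes hol: "f holomorphic_on ball 0 1" and bound: "\<And>z. z \<in> ball 0 1 \<Longrightarrow> cmod (f z) \<le> 1"
  shows "cmod (fps_nth (fps_expansion f 0) n) \<le> 1"
proof (rule field_le_mult_one_interval)
  fix s :: real
  assume s: "0 < s" "s < 1"
  show "s * cmod (fps_nth (fps_expansion f 0) n) \<le> 1"
  proof (cases "n = 0")
    case True
    have "cmod (f 0) \<le> 1" using bound[of 0] by simp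
    with s have "s * cmod (f 0) \<le> 1 * 1" by (intro mult_mono) auto
    then show ?thesis using True by (simp add: fps_expansion_def)
  next
    case False
    define r where "r = root n s"
    have r: "0 < r" "r < 1" "r ^ n = s"
      using False s by (simp_all add: r_def)
    have sub: "cball 0 r \<subseteq> ball (0::complex) 1" using r by auto
    have "cmod ((deriv ^^ n) f 0) \<le> fact n * 1 / r ^ n"
    proof (rule Cauchy_inequality)
      show "f holomorphic_on ball 0 r"
        using hol holomorphic_on_subset sub ball_subset_cball by blast
      show "continuous_on (cball 0 r) f"
        using hol holomorphic_on_subset sub holomorphic_on_imp_continuous_on by blast
      show "cmod (f x) \<le> 1" if "cmod (0 - x) = r" for x
        using that r by (intro bound) auto
    qed (use r in auto)
    then show ?thesis
      using s r by (simp add: fps_expansion_def norm_divide field_simps)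
  qed
qed

lemma norm_Moebius_le_1:
  assumes a: "cmod a < 1" and z: "cmod z \<le> 1"
  shows "1 - cnj a * z \<noteq> 0" "cmod ((z - a) / (1 - cnj a * z)) \<le> 1"
proof -
  have "cmod (cnj a * z) \<le> cmod a * 1"
    unfolding norm_mult complex_mod_cnj using z by (intro mult_left_mono) auto
  with a show ne: "1 - cnj a * z \<noteq> 0" by auto
  have "complex_of_real ((cmod (1 - cnj a * z))\<^sup>2 - (cmod (z - a))\<^sup>2)
      = complex_of_real ((1 - (cmod a)\<^sup>2) * (1 - (cmod z)\<^sup>2))"
    unfolding of_real_diff of_real_mult of_real_1 complex_norm_square
    by (simp add: algebra_simps)
  then have eq: "(cmod (1 - cnj a * z))\<^sup>2 - (cmod (z - a))\<^sup>2 = (1 - (cmod a)\<^sup>2) * (1 - (cmod z)\<^sup>2)"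
    unfolding of_real_eq_iff .
  have "0 \<le> (1 - (cmod a)\<^sup>2) * (1 - (cmod z)\<^sup>2)"
    using a z by (intro mult_nonneg_nonneg) (auto simp: power_le_one)
  then have "(cmod (z - a))\<^sup>2 \<le> (cmod (1 - cnj a * z))\<^sup>2"
    using eq by linarith
  then have "cmod (z - a) \<le> cmod (1 - cnj a * z)"
    by (rule power2_le_imp_le) simp
  then show "cmod ((z - a) / (1 - cnj a * z)) \<le> 1"
    using ne by (simp add: norm_divide divide_simps)
qed

text \<open>When the coefficients between \<open>0\<close> and \<open>k\<close> vanish, composing with the disk automorphism that takes \<open>f 0\<close>
to \<open>0\<close> divides the \<open>k\<close>-th coefficient by exactly \<open>1 - \<bar>f 0\<bar>\<^sup>2\<close>, and the composition is still bounded by \<open>1\<close>.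
If \<open>\<bar>f 0\<bar> = 1\<close> this automorphism degenerates, but then \<open>f\<close> is constant.\<close>

lemma gap_fps_nth_bound:
  assumes hol: "f holomorphic_on ball 0 1" and bound: "\<And>z. z \<in> ball 0 1 \<Longrightarrow> cmod (f z) \<le> 1"
    and k: "0 < k" and gap: "\<And>m. 0 < m \<Longrightarrow> m < k \<Longrightarrow> fps_nth (fps_expansion f 0) m = 0"
  shows "cmod (fps_nth (fps_expansion f 0) k) \<le> 1 - (cmod (f 0))\<^sup>2"
proof (cases "cmod (f 0) < 1")
  case True
  define a where "a = f 0"
  define M where "M = (\<lambda>z. (f z - a) / (1 - cnj a * f z))"
  have a: "cmod a < 1" using True by (simp add: a_def)
  have M: "1 - cnj a * f z \<noteq> 0" "cmod (M z) \<le> 1" if "z \<in> ball 0 1" for z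
    using norm_Moebius_le_1[OF a bound[OF that]] by (auto simp: M_def)
  have holM: "M holomorphic_on ball 0 1"
    unfolding M_def using M by (intro holomorphic_intros hol) auto
  have F: "f has_fps_expansion fps_expansion f 0" and FM: "M has_fps_expansion fps_expansion M 0"
    using hol holM by (auto intro!: has_fps_expansion_fps_expansion[of "ball 0 1"])
  let ?F = "fps_expansion f 0" and ?M = "fps_expansion M 0"
  have "(\<lambda>z. f z - a) has_fps_expansion ?M * (1 - fps_const (cnj a) * ?F)"
  proof -
    have "(\<lambda>z. M z * (1 - cnj a * f z)) has_fps_expansion ?M * (1 - fps_const (cnj a) * ?F)"
      by (intro fps_expansion_intros F FM)
    moreover have "eventually (\<lambda>z. M z * (1 - cnj a * f z) = f z - a) (nhds 0)"
    by (rule eventually_mono[OF eventually_nhds_in_open[of "ball 0 1"]]) (use M in \<open>auto simp: M_def\<close>)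
    ultimately show ?thesis
      by (simp cong: has_fps_expansion_cong)
  qed
  moreover have "(\<lambda>z. f z - a) has_fps_expansion ?F - fps_const a"
    by (intro fps_expansion_intros F)
  ultimately have eq: "?F - fps_const a = ?M * (1 - fps_const (cnj a) * ?F)"
    by (metis fps_expansion_unique_complex)
  have F0: "fps_nth ?F 0 = a" by (simp add: fps_expansion_def a_def)
  have M0: "fps_nth ?M 0 = 0" by (simp add: fps_expansion_def M_def a_def)
  have nth: "fps_nth ?F k = (\<Sum>i=0..k. fps_nth ?M i * fps_nth (1 - fps_const (cnj a) * ?F) (k - i))"
    using arg_cong[OF eq, of "\<lambda>G. fps_nth G k"] k by (simp add: fps_mult_nth)
  also have "\<dots> = (\<Sum>i\<in>{k}. fps_nth ?M i * fps_nth (1 - fps_const (cnj a) * ?F) (k - i))"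
  proof (rule sum.mono_neutral_right)
    show "\<forall>i\<in>{0..k} - {k}. fps_nth ?M i * fps_nth (1 - fps_const (cnj a) * ?F) (k - i) = 0"
    proof
      fix i assume i: "i \<in> {0..k} - {k}"
      show "fps_nth ?M i * fps_nth (1 - fps_const (cnj a) * ?F) (k - i) = 0"
        using i k gap[of "k - i"] M0 by (cases "i = 0") auto
    qed
  qed (use k in auto)
  also have "\<dots> = fps_nth ?M k * of_real (1 - (cmod a)\<^sup>2)"
    using F0 by (simp add: complex_norm_square mult.commute del: of_real_power)
  finally have "cmod (fps_nth ?F k) = cmod (fps_nth ?M k) * (1 - (cmod a)\<^sup>2)"
    using a by (simp add: norm_mult power_le_one del: of_real_diff)
  also have "\<dots> \<le> 1 * (1 - (cmod a)\<^sup>2)"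
    using bounded_holomorphic_fps_nth_le_1[OF holM M(2)] a
    by (intro mult_right_mono) (auto simp: power_le_one)
  finally show ?thesis by (simp add: a_def)
next
  case False
  then have f0: "cmod (f 0) = 1" using bound[of 0] by simp
  have "f constant_on ball 0 1"
    by (rule maximum_modulus_principle[OF hol, of "ball 0 1" 0]) (use bound f0 in auto)
  then obtain c where c: "\<And>z. z \<in> ball 0 1 \<Longrightarrow> f z = c" by (auto simp: constant_on_def)
  have "eventually (\<lambda>z. f z = c) (nhds 0)"
    by (rule eventually_mono[OF eventually_nhds_in_open[of "ball 0 1"]]) (use c in auto)
  then have "f has_fps_expansion fps_const c"
    by (simp cong: has_fps_expansion_cong)
  moreover have "f has_fps_expansion fps_expansion f 0"
    using hol by (auto intro!: has_fps_expansion_fps_expansion[of "ball 0 1"])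
  ultimately have "fps_expansion f 0 = fps_const c"
    by (metis fps_expansion_unique_complex)
  then show ?thesis using k f0 by simp
qed

text \<open>Averaging \<open>f\<close> over the rotations by the \<open>k\<close>-th roots of unity preserves the bound and the coefficients
of index divisible by \<open>k\<close> and kills the others, which creates the gap assumed in the previous lemma.\<close>

lemma fps_nth_le_1_minus_square:
  assumes hol: "f holomorphic_on ball 0 1" and bound: "\<And>z. z \<in> ball 0 1 \<Longrightarrow> cmod (f z) \<le> 1"
    and k: "0 < k"
  shows "cmod (fps_nth (fps_expansion f 0) k) \<le> 1 - (cmod (f 0))\<^sup>2"
proof -
  define w where "w = exp (2 * of_real pi * \<i> / of_nat k)"
  define g where "g = (\<lambda>z. (\<Sum>j<k. f (w ^ j * z)) / of_nat k)"
  have w1: "cmod (w ^ j) = 1" for j by (simp add: w_def norm_power norm_exp_eq_Re)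
  have in_ball: "w ^ j * z \<in> ball 0 1" if "z \<in> ball 0 1" for j z
    using that w1[of j] by (simp add: norm_mult)
  have hol_j: "(\<lambda>z. f (w ^ j * z)) holomorphic_on ball 0 1" for j
    using in_ball by (intro holomorphic_on_compose_gen[OF _ hol, unfolded o_def] holomorphic_intros) auto
  have holg: "g holomorphic_on ball 0 1"
    unfolding g_def using k by (intro holomorphic_intros hol_j) auto
  have boundg: "cmod (g z) \<le> 1" if "z \<in> ball 0 1" for z
  proof -
    have "cmod (\<Sum>j<k. f (w ^ j * z)) \<le> of_nat (card {..<k}) * 1"
      by (rule sum_norm_bound) (use bound in_ball[OF that] in auto)
    then show ?thesis using k by (simp add: g_def norm_divide divide_simps)
  qed
  have nth: "fps_nth (fps_expansion g 0) m
      = fps_nth (fps_expansion f 0) m * ((\<Sum>j<k. (w ^ m) ^ j) / of_nat k)" for m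
  proof -
    have "g has_fps_expansion (\<Sum>j<k. fps_expansion (\<lambda>z. f (w ^ j * z)) 0) / fps_const (of_nat k)"
      unfolding g_def using k hol_j
      by (intro fps_expansion_intros has_fps_expansion_fps_expansion[of "ball 0 1"]) auto
    moreover have "g has_fps_expansion fps_expansion g 0"
      using holg by (auto intro!: has_fps_expansion_fps_expansion[of "ball 0 1"])
    ultimately have "fps_expansion g 0 = (\<Sum>j<k. fps_expansion (\<lambda>z. f (w ^ j * z)) 0) / fps_const (of_nat k)"
      by (metis fps_expansion_unique_complex)
    then have "fps_nth (fps_expansion g 0) m
        = (\<Sum>j<k. fps_nth (fps_expansion (\<lambda>z. f (w ^ j * z)) 0) m) / of_nat k"
      using k by (simp add: fps_sum_nth fps_divide_unit fps_const_inverse divide_inverse)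
    also have "(\<Sum>j<k. fps_nth (fps_expansion (\<lambda>z. f (w ^ j * z)) 0) m)
        = (\<Sum>j<k. (w ^ m) ^ j * fps_nth (fps_expansion f 0) m)"
    proof (rule sum.cong[OF refl])
      fix j
      have "(deriv ^^ m) (\<lambda>z. f (w ^ j * z)) 0 = (w ^ j) ^ m * (deriv ^^ m) f (w ^ j * 0)"
        by (rule higher_deriv_compose_linear[OF hol, of "ball 0 1"]) (use in_ball in auto)
      then show "fps_nth (fps_expansion (\<lambda>z. f (w ^ j * z)) 0) m
          = (w ^ m) ^ j * fps_nth (fps_expansion f 0) m"
        by (simp add: fps_expansion_def power_mult[symmetric] mult.commute)
    qed
    finally show ?thesis by (simp add: sum_distrib_right[symmetric])
  qed
  have wm: "w ^ m = exp (2 * of_real pi * \<i> * of_nat m / of_nat k)" for m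
    by (simp add: w_def exp_of_nat_mult[symmetric] mult_ac)
  have wk: "w ^ k = 1"
    unfolding wm using k by simp
  have "fps_nth (fps_expansion g 0) m = 0" if m: "0 < m" "m < k" for m
  proof -
    have "w ^ m \<noteq> 1"
      unfolding wm using complex_root_unity_eq_1[of k m] m k by (auto dest: dvd_imp_le)
    moreover have "(w ^ m) ^ k = (w ^ k) ^ m"
      by (simp add: power_mult[symmetric] mult.commute)
    then have "(w ^ m) ^ k = 1"
      using wk by simp
    ultimately have "(\<Sum>j<k. (w ^ m) ^ j) = 0"
      by (simp add: geometric_sum)
    then show ?thesis by (simp add: nth)
  qed
  from gap_fps_nth_bound[OF holg boundg k this]
  have "cmod (fps_nth (fps_expansion g 0) k) \<le> 1 - (cmod (g 0))\<^sup>2" .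
  moreover have "fps_nth (fps_expansion g 0) k = fps_nth (fps_expansion f 0) k"
    using nth[of k] wk k by simp
  moreover have "g 0 = f 0" using k by (simp add: g_def)
  ultimately show ?thesis by simp
qed

section \<open>The Zalcman functional in one variable\<close>

text \<open>Comparing coefficients in the differential equation expresses \<open>(n+1) H\<^sub>n\<^sub>+\<^sub>1\<close> by \<open>P\<^sub>0, \<dots>, P\<^sub>n\<close> and
\<open>H\<^sub>0, \<dots>, H\<^sub>n\<close>; four steps of this recursion determine both terms. In the difference the square of \<open>P\<^sub>1\<close>
cancels, so every term but the first is linear in the higher coefficients \<open>P\<^sub>1, P\<^sub>2, P\<^sub>3\<close>.\<close>

lemma fps_zalcman_of_ode:
  fixes H P :: "complex fps"
  assumes ode: "fps_deriv H = P * (2 * H + fps_X * fps_deriv H)" and H0: "fps_nth H 0 = 1"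
  shows "(fps_nth H 2)\<^sup>2 - fps_nth H 4 =
           4 * fps_nth P 0 ^ 4 - 7/6 * (fps_nth P 0)\<^sup>2 * fps_nth P 1
           - 7/3 * fps_nth P 0 * fps_nth P 2 - 1/2 * fps_nth P 3"
proof -
  have rec: "of_nat (Suc n) * fps_nth H (Suc n) =
      (\<Sum>i\<le>n. fps_nth P i * ((2 + of_nat (n - i)) * fps_nth H (n - i)))" for n
  proof -
    have two: "fps_nth (2 * H + fps_X * fps_deriv H) m = (2 + of_nat m) * fps_nth H m" for m
      by (cases m) (simp_all add: numeral_fps_const algebra_simps)
    have "of_nat (Suc n) * fps_nth H (Suc n) = fps_nth (fps_deriv H) n"
      by simp
    also have "\<dots> = (\<Sum>i\<le>n. fps_nth P i * ((2 + of_nat (n - i)) * fps_nth H (n - i)))"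
      by (subst ode) (simp only: fps_mult_nth two atLeast0AtMost)
    finally show ?thesis .
  qed
  have 1: "fps_nth H 1 = 2 * fps_nth P 0"
    using rec[of 0] H0 by simp
  have 2: "2 * fps_nth H 2 = 3 * fps_nth P 0 * fps_nth H 1 + 2 * fps_nth P 1"
    using rec[of 1] H0 by (simp add: numeral_2_eq_2)
  have 3: "3 * fps_nth H 3 = 4 * fps_nth P 0 * fps_nth H 2 + 3 * fps_nth P 1 * fps_nth H 1 + 2 * fps_nth P 2"
    using rec[of 2] H0 by (simp add: eval_nat_numeral algebra_simps)
  have 4: "4 * fps_nth H 4 = 5 * fps_nth P 0 * fps_nth H 3 + 4 * fps_nth P 1 * fps_nth H 2
      + 3 * fps_nth P 2 * fps_nth H 1 + 2 * fps_nth P 3"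
    using rec[of 3] H0 by (simp add: eval_nat_numeral algebra_simps)
  have "6 * ((fps_nth H 2)\<^sup>2 - fps_nth H 4) = 24 * fps_nth P 0 ^ 4
      - 7 * (fps_nth P 0)\<^sup>2 * fps_nth P 1 - 14 * fps_nth P 0 * fps_nth P 2 - 3 * fps_nth P 3"
    using 1 2 3 4 by algebra
  then show ?thesis
    by (simp add: field_simps, algebra)
qed

text \<open>The difference of the two sides has the factor \<open>1 - x\<^sup>2\<close>, and the cofactor is a quadratic without real
zeros.\<close>

lemma zalcman_real_bound:
  fixes x :: real
  assumes "0 \<le> x" "x \<le> 1"
  shows "4 * x ^ 4 + 7/6 * x\<^sup>2 * (1 - x\<^sup>2) + 7/3 * x * (1 - x\<^sup>2) + 1/2 * (1 - x\<^sup>2) \<le> 4"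
proof -
  have q: "0 \<le> 17/6 * x\<^sup>2 - 7/3 * x + 7/2"
  proof -
    have "17/6 * x\<^sup>2 - 7/3 * x + 7/2 = 17/6 * (x - 7/17)\<^sup>2 + (7/2 - 49/102)"
      by (simp add: power2_eq_square algebra_simps)
    then show ?thesis by simp
  qed
  have "0 \<le> 1 - x\<^sup>2"
    using assms by (simp add: power_le_one)
  then have "0 \<le> (1 - x\<^sup>2) * (17/6 * x\<^sup>2 - 7/3 * x + 7/2)"
    using q by simp
  also have "\<dots> = 4 - (4 * x ^ 4 + 7/6 * x\<^sup>2 * (1 - x\<^sup>2) + 7/3 * x * (1 - x\<^sup>2) + 1/2 * (1 - x\<^sup>2))"
    by (simp add: field_simps power2_eq_square power4_eq_xxxx)
  finally show ?thesis by simp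
qed

lemma zalcman_functional_eq:
  assumes holh: "h holomorphic_on ball 0 1" and P: "p has_fps_expansion P"
    and h0: "h 0 = 1"
    and ode: "\<And>z. z \<in> ball 0 1 \<Longrightarrow> deriv h z = p z * (2 * h z + z * deriv h z)"
  shows "((deriv ^^ 2) h 0 / fact 2)\<^sup>2 - (deriv ^^ 4) h 0 / fact 4 =
           4 * fps_nth P 0 ^ 4 - 7/6 * (fps_nth P 0)\<^sup>2 * fps_nth P 1
           - 7/3 * fps_nth P 0 * fps_nth P 2 - 1/2 * fps_nth P 3"
proof -
  let ?H = "fps_expansion h 0"
  have H: "h has_fps_expansion ?H"
    using holh by (auto intro!: has_fps_expansion_fps_expansion[of "ball 0 1"])
  have "(\<lambda>z. p z * (2 * h z + z * deriv h z)) has_fps_expansion P * (2 * ?H + fps_X * fps_deriv ?H)"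
    by (intro fps_expansion_intros H P)
  moreover have "eventually (\<lambda>z. p z * (2 * h z + z * deriv h z) = deriv h z) (nhds 0)"
    by (rule eventually_mono[OF eventually_nhds_in_open[of "ball 0 1"]]) (use ode in auto)
  ultimately have "deriv h has_fps_expansion P * (2 * ?H + fps_X * fps_deriv ?H)"
    by (simp cong: has_fps_expansion_cong)
  moreover have "deriv h has_fps_expansion fps_deriv ?H"
    by (intro fps_expansion_intros H)
  ultimately have "fps_deriv ?H = P * (2 * ?H + fps_X * fps_deriv ?H)"
    by (metis fps_expansion_unique_complex)
  from fps_zalcman_of_ode[OF this] show ?thesis
    using h0 by (simp add: fps_expansion_def)
qed

lemma zalcman_functional_bound:
  assumes holh: "h holomorphic_on ball 0 1" and holp: "p holomorphic_on ball 0 1"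
    and h0: "h 0 = 1" and bound: "\<And>z. z \<in> ball 0 1 \<Longrightarrow> cmod (p z) \<le> 1"
    and ode: "\<And>z. z \<in> ball 0 1 \<Longrightarrow> deriv h z = p z * (2 * h z + z * deriv h z)"
  shows "cmod (((deriv ^^ 2) h 0 / fact 2)\<^sup>2 - (deriv ^^ 4) h 0 / fact 4) \<le> 4"
proof -
  let ?P = "fps_expansion p 0"
  have "p has_fps_expansion ?P"
    using holp by (auto intro!: has_fps_expansion_fps_expansion[of "ball 0 1"])
  note eq = zalcman_functional_eq[OF holh this h0 ode]
  define x where "x = cmod (p 0)"
  have x: "0 \<le> x" "x \<le> 1" using bound[of 0] by (auto simp: x_def)
  have P0: "cmod (fps_nth ?P 0) = x" by (simp add: fps_expansion_def x_def)
  have Pk: "cmod (fps_nth ?P k) \<le> 1 - x\<^sup>2" if "0 < k" for k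
    using fps_nth_le_1_minus_square[OF holp bound that] by (simp add: x_def)
  have "cmod (4 * fps_nth ?P 0 ^ 4 - 7/6 * (fps_nth ?P 0)\<^sup>2 * fps_nth ?P 1
           - 7/3 * fps_nth ?P 0 * fps_nth ?P 2 - 1/2 * fps_nth ?P 3)
      \<le> cmod (4 * fps_nth ?P 0 ^ 4) + cmod (7/6 * (fps_nth ?P 0)\<^sup>2 * fps_nth ?P 1)
           + cmod (7/3 * fps_nth ?P 0 * fps_nth ?P 2) + cmod (1/2 * fps_nth ?P 3)"
    by (intro order.trans[OF norm_triangle_ineq4] add_mono order.refl)
  also have "\<dots> = 4 * x ^ 4 + 7/6 * x\<^sup>2 * cmod (fps_nth ?P 1) + 7/3 * x * cmod (fps_nth ?P 2)
      + 1/2 * cmod (fps_nth ?P 3)"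
    by (simp add: norm_mult norm_divide norm_power P0)
  also have "\<dots> \<le> 4 * x ^ 4 + 7/6 * x\<^sup>2 * (1 - x\<^sup>2) + 7/3 * x * (1 - x\<^sup>2) + 1/2 * (1 - x\<^sup>2)"
    using x by (intro add_mono mult_left_mono Pk) auto
  also have "\<dots> \<le> 4" by (rule zalcman_real_bound[OF x])
  finally show ?thesis
    by (simp only: eq)
qed

section \<open>Complex differentiable functions of several variables\<close>

lemma norm_vector_smult: "norm (c *s (x :: complex^'n)) = cmod c * norm x"
  by (simp add: norm_vec_def norm_mult L2_set_right_distrib)

lemma continuous_on_vector_smult [continuous_intros]:
  fixes v :: "complex^'n"
  shows "continuous_on A f \<Longrightarrow> continuous_on A (\<lambda>x. f x *s v)"
  unfolding vector_scalar_mult_def by (intro continuous_intros)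

lemma bounded_linear_vector_smult: "bounded_linear (\<lambda>c. c *s (v :: complex^'n))"
  unfolding linear_conv_bounded_linear[symmetric]
  by (rule linearI) (simp_all add: vec_eq_iff algebra_simps)

lemma clinear_iff:
  "Vector_Spaces.linear (*s) (*) (L :: complex^'n \<Rightarrow> complex) \<longleftrightarrow>
     (\<forall>x y. L (x + y) = L x + L y) \<and> (\<forall>c x. L (c *s x) = c * L x)"
  using vec.vector_space_axioms vector_space_over_itself.vector_space_axioms
  by (auto simp: Vector_Spaces.linear_iff)

lemma clinear_vec_iff:
  "Vector_Spaces.linear (*s) (*s) (L :: complex^'n \<Rightarrow> complex^'m) \<longleftrightarrow>
     (\<forall>x y. L (x + y) = L x + L y) \<and> (\<forall>c x. L (c *s x) = c *s L x)"
  by (auto simp: Vector_Spaces.linear_iff vec.vector_space_axioms)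

lemma holomorphic_fun_on_frechet:
  assumes "holomorphic_fun_on f S" "z \<in> S"
  shows "(f has_derivative frechet_derivative f (at z)) (at z)"
    and "frechet_derivative f (at z) (c *s v) = c * frechet_derivative f (at z) v"
proof -
  obtain L where L: "(f has_derivative L) (at z)" "Vector_Spaces.linear (*s) (*) L"
    using assms by (auto simp: holomorphic_fun_on_def)
  then have "L = frechet_derivative f (at z)" by (simp add: frechet_derivative_at)
  with L show "(f has_derivative frechet_derivative f (at z)) (at z)"
    and "frechet_derivative f (at z) (c *s v) = c * frechet_derivative f (at z) v"
    by (auto simp: clinear_iff)
qed

lemma holomorphic_fun_onI:
  assumes "open S" "\<And>z. z \<in> S \<Longrightarrow> (f has_derivative L z) (at z)"
    and "\<And>z c v. z \<in> S \<Longrightarrow> L z (c *s v) = c * L z v"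
  shows "holomorphic_fun_on f S"
  unfolding holomorphic_fun_on_def
proof (intro conjI ballI assms(1))
  fix z assume z: "z \<in> S"
  have "linear (L z)" using assms(2)[OF z] by (rule has_derivative_linear)
  with assms(3)[OF z] have "Vector_Spaces.linear (*s) (*) (L z)"
    by (simp add: clinear_iff linear_add)
  with assms(2)[OF z] show "\<exists>L. (f has_derivative L) (at z) \<and> Vector_Spaces.linear (*s) (*) L"
    by blast
qed

lemma holomorphic_fun_on_line:
  fixes f :: "complex^'n \<Rightarrow> complex"
  assumes "holomorphic_fun_on f S" "a + s *s v \<in> S"
  shows "((\<lambda>s. f (a + s *s v)) has_field_derivative frechet_derivative f (at (a + s *s v)) v) (at s)"
proof -
  have "((\<lambda>s. a + s *s v) has_derivative (\<lambda>s. s *s v)) (at s)"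
    using bounded_linear_imp_has_derivative[OF bounded_linear_vector_smult]
    by (intro derivative_eq_intros) auto
  from has_derivative_compose[OF this holomorphic_fun_on_frechet(1)[OF assms]]
  have "((\<lambda>s. f (a + s *s v)) has_derivative
      (\<lambda>x. x * frechet_derivative f (at (a + s *s v)) v)) (at s)"
    by (simp add: holomorphic_fun_on_frechet(2)[OF assms])
  then show ?thesis
    unfolding has_field_derivative_def by (rule has_derivative_eq_rhs) (simp add: fun_eq_iff mult.commute)
qed

lemma holomorphic_fun_on_continuous:
  assumes "holomorphic_fun_on f S"
  shows "continuous_on S f"
  using assms holomorphic_fun_on_frechet(1)
  by (blast intro: continuous_at_imp_continuous_on has_derivative_continuous)

text \<open>The circle is parametrised by the angle, so that the dependence on \<open>a\<close> can be studied by differentiation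
under a real integral.\<close>

lemma frechet_derivative_Cauchy:
  fixes f :: "complex^'n \<Rightarrow> complex"
  assumes f: "holomorphic_fun_on f S" and r: "0 < r"
    and sub: "\<And>s. s \<in> cball 0 r \<Longrightarrow> a + s *s v \<in> S"
  shows "frechet_derivative f (at a) v =
           1 / (2 * of_real pi * of_real r) * integral {0..2*pi} (\<lambda>t. f (a + (of_real r * cis t) *s v) * cis (- t))"
proof -
  let ?k = "\<lambda>s. f (a + s *s v)"
  have der: "(?k has_field_derivative frechet_derivative f (at (a + s *s v)) v) (at s)"
    if "s \<in> cball 0 r" for s
    using holomorphic_fun_on_line[OF f sub[OF that]] .
  have "?k field_differentiable at s within A" if "s \<in> cball 0 r" for s A
    using der[OF that] field_differentiable_at_within field_differentiable_def by blast
  then have hol: "?k holomorphic_on cball 0 r"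
    by (simp add: holomorphic_on_def)
  have "(?k has_field_derivative (1 / (2 * of_real pi * \<i>) *
      contour_integral (circlepath 0 r) (\<lambda>u. ?k u / (u - 0)^2))) (at 0)"
    using hol r by (intro Cauchy_derivative_integral_circlepath holomorphic_on_imp_continuous_on)
      (auto intro: holomorphic_on_subset)
  then have "frechet_derivative f (at a) v
      = 1 / (2 * of_real pi * \<i>) * contour_integral (circlepath 0 r) (\<lambda>u. ?k u / (u - 0)^2)"
    using der[of 0] r by (auto intro: DERIV_unique)
  also have "contour_integral (circlepath 0 r) (\<lambda>u. ?k u / (u - 0)^2)
     = integral {0..2*pi} (\<lambda>t. ?k (0 + r * cis t) / (0 + r * cis t - 0)^2 * r * \<i> * cis t)"
    unfolding circlepath_def by (rule contour_integral_part_circlepath_eq) simp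
  also have "(\<lambda>t. ?k (0 + r * cis t) / (0 + r * cis t - 0)^2 * r * \<i> * cis t)
      = (\<lambda>t. (\<i> / r) * (?k (r * cis t) * cis (- t)))"
  proof
    fix t
    have "cis (- t) * cis t = 1" by (simp add: cis_mult)
    then have "cis (- t) = 1 / cis t" by (simp add: field_simps)
    then show "?k (0 + r * cis t) / (0 + r * cis t - 0)^2 * r * \<i> * cis t
        = (\<i> / r) * (?k (r * cis t) * cis (- t))"
      using r by (simp add: field_simps power2_eq_square)
  qed
  also have "integral {0..2*pi} \<dots> = (\<i> / r) * integral {0..2*pi} (\<lambda>t. ?k (r * cis t) * cis (- t))"
    by (rule integral_mult_right)
  finally show ?thesis using r by (simp add: field_simps)
qed

text \<open>One radius serves in Cauchy's formula for all base points near \<open>z\<close>, so that the formula can be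
differentiated with respect to the base point.\<close>

lemma uniform_Cauchy_radius:
  fixes v :: "complex^'n"
  assumes "open S" "z \<in> S"
  obtains d r where "0 < d" "0 < r" "ball z d \<subseteq> S"
    "\<And>x s. x \<in> ball z d \<Longrightarrow> cmod s \<le> r \<Longrightarrow> x + s *s v \<in> S"
proof -
  obtain e where e: "0 < e" "ball z e \<subseteq> S"
    using assms open_contains_ball by blast
  define r where "r = e / 2 / (norm v + 1)"
  have nv: "0 < norm v + 1" by (simp add: add_nonneg_pos)
  show ?thesis
  proof
    show "0 < e / 2" "ball z (e / 2) \<subseteq> S" using e by auto
    show "0 < r" using e nv by (simp add: r_def)
    fix x s assume x: "x \<in> ball z (e / 2)" and s: "cmod s \<le> r"
    have "norm (s *s v) \<le> r * (norm v + 1)"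
      unfolding norm_vector_smult using s nv order.trans[OF norm_ge_zero s] by (intro mult_mono) auto
    also have "r * (norm v + 1) = e / 2" using nv by (simp add: r_def del: distrib_left_numeral)
    finally have "norm (s *s v) \<le> e / 2" .
    then have "dist z (x + s *s v) < e"
      using x norm_triangle_ineq4[of "z - x" "s *s v"] by (simp add: dist_norm algebra_simps)
    then show "x + s *s v \<in> S" using e by auto
  qed
qed

lemma continuous_on_circle_translate:
  fixes v :: "complex^'n" and g :: "complex^'n \<Rightarrow> complex"
  assumes g: "continuous_on S g" and r: "0 < r"
    and sub: "\<And>x s. x \<in> U \<Longrightarrow> cmod s \<le> r \<Longrightarrow> x + s *s v \<in> S"
  shows "continuous_on (U \<times> T) (\<lambda>(x, t). g (x + (of_real r * cis t) *s v) * cis (- t))"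
  unfolding split_beta
  by (intro continuous_intros continuous_on_compose2[OF g])
    (use r in \<open>auto simp: norm_mult intro!: sub\<close>)

text \<open>Needed before differentiating under the integral sign, which requires a continuous derivative; by
Cauchy's formula it is inherited from \<open>f\<close> itself.\<close>

lemma continuous_on_frechet_derivative:
  fixes f :: "complex^'n \<Rightarrow> complex"
  assumes f: "holomorphic_fun_on f S"
  shows "continuous_on S (\<lambda>z. frechet_derivative f (at z) v)"
proof (rule continuous_at_imp_continuous_on, rule ballI)
  fix z assume z: "z \<in> S"
  have "open S" using f by (simp add: holomorphic_fun_on_def)
  then obtain d r where d: "0 < d" "0 < r" "ball z d \<subseteq> S"
    and sub: "\<And>x s. x \<in> ball z d \<Longrightarrow> cmod s \<le> r \<Longrightarrow> x + s *s v \<in> S"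
    using uniform_Cauchy_radius[OF _ z] by metis
  have "continuous_on (ball z d) (\<lambda>x. 1 / (2 * of_real pi * of_real r) *
      integral (cbox 0 (2*pi)) (\<lambda>t. f (x + (of_real r * cis t) *s v) * cis (- t)))"
    by (intro continuous_intros integral_continuous_on_param
        continuous_on_circle_translate[OF holomorphic_fun_on_continuous[OF f] d(2) sub])
  moreover have "frechet_derivative f (at x) v = 1 / (2 * of_real pi * of_real r) *
      integral (cbox 0 (2*pi)) (\<lambda>t. f (x + (of_real r * cis t) *s v) * cis (- t))"
    if "x \<in> ball z d" for x
    using frechet_derivative_Cauchy[OF f d(2) sub[OF that]] by simp
  ultimately have "continuous_on (ball z d) (\<lambda>x. frechet_derivative f (at x) v)"
    by (rule continuous_on_eq[OF _ sym])
  then show "isCont (\<lambda>x. frechet_derivative f (at x) v) z"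
    using d(1) by (simp add: continuous_on_eq_continuous_at)
qed

text \<open>The derivative is differentiated through its Cauchy integral, and its complex linearity is that of
the integrand. Iterating this lemma gives the derivatives of all orders.\<close>

lemma holomorphic_fun_on_directional_derivative:
  fixes f :: "complex^'n \<Rightarrow> complex"
  assumes f: "holomorphic_fun_on f S"
  shows "holomorphic_fun_on (\<lambda>z. frechet_derivative f (at z) v) S"
  unfolding holomorphic_fun_on_def
proof (intro conjI ballI)
  show S: "open S" using f by (simp add: holomorphic_fun_on_def)
  fix z assume z: "z \<in> S"
  from uniform_Cauchy_radius[OF S z] obtain d r where d: "0 < d" "0 < r" "ball z d \<subseteq> S"
    and sub: "\<And>x s. x \<in> ball z d \<Longrightarrow> cmod s \<le> r \<Longrightarrow> x + s *s v \<in> S" by metis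
  define K where "K = 1 / (2 * complex_of_real pi * of_real r)"
  define y where "y = (\<lambda>x t. x + (of_real r * cis t) *s v)"
  define fx where "fx = (\<lambda>x t. Blinfun (\<lambda>h. frechet_derivative f (at (y x t)) h * cis (- t)))"
  have y: "y x t \<in> S" if "x \<in> ball z d" for x t
    unfolding y_def by (rule sub[OF that]) (use d in \<open>simp add: norm_mult\<close>)
  have fx: "blinfun_apply (fx x t) = (\<lambda>h. frechet_derivative f (at (y x t)) h * cis (- t))"
    if "x \<in> ball z d" for x t
    unfolding fx_def
    by (intro bounded_linear_Blinfun_apply bounded_linear_mult_const
        has_derivative_bounded_linear[OF holomorphic_fun_on_frechet(1)[OF f y[OF that]]])
  have zd: "z \<in> ball z d" using d by simp
  have cont_fx: "continuous_on (ball z d \<times> cbox 0 (2*pi)) (\<lambda>(x, t). fx x t)"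
  proof (rule continuous_on_blinfun_componentwise)
    fix i :: "complex^'n"
    have "continuous_on (ball z d \<times> cbox 0 (2*pi))
        (\<lambda>(x, t). frechet_derivative f (at (x + (of_real r * cis t) *s v)) i * cis (- t))"
      by (rule continuous_on_circle_translate[OF continuous_on_frechet_derivative[OF f] d(2) sub])
    then show "continuous_on (ball z d \<times> cbox 0 (2*pi)) (\<lambda>p. blinfun_apply (case p of (x, t) \<Rightarrow> fx x t) i)"
      by (rule continuous_on_eq) (auto simp: fx[unfolded mem_ball] y_def)
  qed
  have "((\<lambda>x. integral (cbox 0 (2*pi)) (\<lambda>t. f (y x t) * cis (- t))) has_derivative
      blinfun_apply (integral (cbox 0 (2*pi)) (fx z))) (at z within ball z d)"
  proof (rule leibniz_rule[OF _ _ cont_fx zd convex_ball])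
    fix x t assume x: "x \<in> ball z d"
    have "((\<lambda>x. y x t) has_derivative (\<lambda>h. h)) (at x within ball z d)"
      unfolding y_def by (auto intro!: derivative_eq_intros)
    from has_derivative_compose[OF this holomorphic_fun_on_frechet(1)[OF f y[OF x]]]
    show "((\<lambda>x. f (y x t) * cis (- t)) has_derivative blinfun_apply (fx x t)) (at x within ball z d)"
      unfolding fx[OF x] by (rule has_derivative_mult_left)
  next
    fix x assume x: "x \<in> ball z d"
    have "continuous_on (ball z d \<times> cbox 0 (2*pi))
        (\<lambda>(x, t). f (x + (of_real r * cis t) *s v) * cis (- t))"
      by (rule continuous_on_circle_translate[OF holomorphic_fun_on_continuous[OF f] d(2) sub])
    then have "continuous_on (cbox 0 (2*pi)) (\<lambda>t. case (x, t) of (x, t) \<Rightarrow> f (x + (of_real r * cis t) *s v) * cis (- t))"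
      by (rule continuous_on_compose2) (use x in \<open>auto intro!: continuous_intros\<close>)
    then have "continuous_on (cbox 0 (2*pi)) (\<lambda>t. f (y x t) * cis (- t))"
      by (simp add: y_def)
    then show "(\<lambda>t. f (y x t) * cis (- t)) integrable_on cbox 0 (2*pi)"
      by (rule integrable_continuous)
  qed
  then have "((\<lambda>x. K * integral (cbox 0 (2*pi)) (\<lambda>t. f (y x t) * cis (- t))) has_derivative
      (\<lambda>h. K * blinfun_apply (integral (cbox 0 (2*pi)) (fx z)) h)) (at z)"
    unfolding at_within_open[OF zd open_ball] by (rule has_derivative_mult_right)
  then have "((\<lambda>x. frechet_derivative f (at x) v) has_derivative
      (\<lambda>h. K * blinfun_apply (integral (cbox 0 (2*pi)) (fx z)) h)) (at z)"
    by (rule has_derivative_transform_within_open[OF _ open_ball zd])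
      (use frechet_derivative_Cauchy[OF f d(2) sub] in \<open>simp add: K_def y_def\<close>)
  moreover have "blinfun_apply (integral (cbox 0 (2*pi)) (fx z)) (c *s h)
      = c * blinfun_apply (integral (cbox 0 (2*pi)) (fx z)) h" for c h
  proof -
    have "continuous_on (cbox 0 (2*pi)) (\<lambda>t. case (z, t) of (x, t) \<Rightarrow> fx x t)"
      by (rule continuous_on_compose2[OF cont_fx]) (use zd in \<open>auto intro!: continuous_intros\<close>)
    then have "continuous_on (cbox 0 (2*pi)) (fx z)"
      by simp
    then have "blinfun_apply (integral (cbox 0 (2*pi)) (fx z)) h
        = integral (cbox 0 (2*pi)) (\<lambda>t. blinfun_apply (fx z t) h)" for h
      by (intro blinfun_apply_integral integrable_continuous)
    then have "blinfun_apply (integral (cbox 0 (2*pi)) (fx z)) h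
        = integral (cbox 0 (2*pi)) (\<lambda>t. frechet_derivative f (at (y z t)) h * cis (- t))" for h
      by (simp only: fx[OF zd])
    then show ?thesis
      by (simp add: holomorphic_fun_on_frechet(2)[OF f y[OF zd]] mult.assoc del: cbox_interval)
  qed
  ultimately show "\<exists>L. ((\<lambda>x. frechet_derivative f (at x) v) has_derivative L) (at z)
      \<and> Vector_Spaces.linear (*s) (*) L"
    by (intro exI[of _ "\<lambda>h. K * blinfun_apply (integral (cbox 0 (2*pi)) (fx z)) h"])
      (auto simp: clinear_iff blinfun.add_right algebra_simps)
qed


section \<open>Iterated derivatives\<close>

lemma frechet_derivative_cong_open:
  assumes "open S" "x \<in> S" "\<And>y. y \<in> S \<Longrightarrow> f y = g y"
  shows "frechet_derivative f (at x) = frechet_derivative g (at x)"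
proof -
  have "(f has_derivative L) (at x) \<longleftrightarrow> (g has_derivative L) (at x)" for L
    using has_derivative_transform_within_open[OF _ assms(1,2)] assms(3) by metis
  then show ?thesis by (simp add: frechet_derivative_def)
qed

lemma Dn_Cons: "Dn F (v # vs) = (\<lambda>z. frechet_derivative (Dn F vs) (at z) v)"
  by (rule ext) simp

lemma Dn_Nil: "Dn F [] = F"
  by (rule ext) simp

lemma holomorphic_fun_on_Dn:
  "holomorphic_fun_on f S \<Longrightarrow> holomorphic_fun_on (Dn f vs) S"
  by (induction vs) (simp_all only: Dn_Nil Dn_Cons holomorphic_fun_on_directional_derivative)

text \<open>The last argument in the list is the direction of the first differentiation, where complex linearity is
available; the scalar then commutes with all later derivatives.\<close>

lemma Dn_smult_last:
  assumes f: "holomorphic_fun_on f S" and x: "x \<in> S"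
  shows "Dn f (vs @ [c *s w]) x = c * Dn f (vs @ [w]) x"
  using x
proof (induction vs arbitrary: x)
  case Nil
  then show ?case by (simp add: Dn_Nil holomorphic_fun_on_frechet(2)[OF f])
next
  case (Cons v vs)
  have S: "open S" using f by (simp add: holomorphic_fun_on_def)
  have "((\<lambda>x. c * Dn f (vs @ [w]) x) has_derivative
      (\<lambda>h. c * frechet_derivative (Dn f (vs @ [w])) (at x) h)) (at x)"
    by (intro has_derivative_mult_right holomorphic_fun_on_frechet(1)[OF holomorphic_fun_on_Dn[OF f] Cons.prems])
  then have "frechet_derivative (\<lambda>x. c * Dn f (vs @ [w]) x) (at x) v
      = c * frechet_derivative (Dn f (vs @ [w])) (at x) v"
    by (simp add: frechet_derivative_at[symmetric])
  moreover have "frechet_derivative (Dn f (vs @ [c *s w])) (at x)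
      = frechet_derivative (\<lambda>x. c * Dn f (vs @ [w]) x) (at x)"
    by (rule frechet_derivative_cong_open[OF S Cons.prems Cons.IH])
  ultimately show ?case by simp
qed

lemma has_derivative_vec_lambda:
  fixes f :: "'n::finite \<Rightarrow> 'a::euclidean_space \<Rightarrow> complex"
  assumes "\<And>i. (f i has_derivative f' i) (at x)"
  shows "((\<lambda>x. \<chi> i. f i x) has_derivative (\<lambda>h. \<chi> i. f' i h)) (at x)"
  unfolding has_derivative_within
proof
  have "linear (f' i)" for i using assms by (rule has_derivative_linear)
  then show "bounded_linear (\<lambda>h. \<chi> i. f' i h)"
    unfolding linear_conv_bounded_linear[symmetric]
    by (intro linearI) (simp_all add: vec_eq_iff linear_add linear_cmul)
  show "((\<lambda>y. (1 / norm (y - x)) *\<^sub>R ((\<chi> i. f i y) - ((\<chi> i. f i x) + (\<chi> i. f' i (y - x))))) \<longlongrightarrow> 0) (at x)"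
    by (rule vec_tendstoI) (use assms in \<open>simp add: has_derivative_within\<close>)
qed

lemma Dn_vec_nth:
  fixes F :: "complex^'n \<Rightarrow> complex^'m"
  assumes F: "\<And>i. holomorphic_fun_on (\<lambda>x. F x $ i) S" and x: "x \<in> S"
  shows "Dn F vs x $ i = Dn (\<lambda>x. F x $ i) vs x"
  using x
proof (induction vs arbitrary: x i)
  case (Cons v vs)
  have S: "open S" using F by (simp add: holomorphic_fun_on_def)
  have "((\<lambda>x. \<chi> i. Dn (\<lambda>x. F x $ i) vs x) has_derivative
      (\<lambda>h. \<chi> i. frechet_derivative (Dn (\<lambda>x. F x $ i) vs) (at x) h)) (at x)"
    by (intro has_derivative_vec_lambda holomorphic_fun_on_frechet(1)[OF holomorphic_fun_on_Dn[OF F] Cons.prems])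
  then have "(Dn F vs has_derivative
      (\<lambda>h. \<chi> i. frechet_derivative (Dn (\<lambda>x. F x $ i) vs) (at x) h)) (at x)"
    by (rule has_derivative_transform_within_open[OF _ S Cons.prems]) (simp add: vec_eq_iff Cons.IH)
  then show ?case
    by (simp add: frechet_derivative_at[symmetric])
qed simp

lemma open_line_vimage: "open S \<Longrightarrow> open {s. s *s (z :: complex^'n) \<in> S}"
  using continuous_open_vimage[OF _ linear_continuous_at[OF bounded_linear_vector_smult[of z]], of S]
  by (simp add: vimage_def)

lemma Dn_replicate_line:
  fixes f :: "complex^'n \<Rightarrow> complex"
  assumes f: "holomorphic_fun_on f S" and s: "s *s z \<in> S"
  shows "Dn f (replicate m z) (s *s z) = (deriv ^^ m) (\<lambda>s. f (s *s z)) s"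
  using s
proof (induction m arbitrary: s)
  case (Suc m)
  have S: "open S" using f by (simp add: holomorphic_fun_on_def)
  have "eventually (\<lambda>s. s *s z \<in> S) (nhds s)"
    using eventually_nhds_in_open[OF open_line_vimage[OF S]] Suc.prems by simp
  then have "eventually (\<lambda>s. Dn f (replicate m z) (s *s z) = (deriv ^^ m) (\<lambda>s. f (s *s z)) s) (nhds s)"
    by (rule eventually_mono) (rule Suc.IH)
  then have "deriv (\<lambda>s. Dn f (replicate m z) (s *s z)) s = deriv ((deriv ^^ m) (\<lambda>s. f (s *s z))) s"
    by (intro deriv_cong_ev) auto
  moreover have "deriv (\<lambda>s. Dn f (replicate m z) (s *s z)) s
      = frechet_derivative (Dn f (replicate m z)) (at (s *s z)) z"
    using holomorphic_fun_on_line[OF holomorphic_fun_on_Dn[OF f], of 0 s z] Suc.prems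
    by (simp add: DERIV_imp_deriv)
  ultimately show ?case by simp
qed simp

lemma holomorphic_on_line:
  assumes "holomorphic_fun_on f S" "\<And>s. s \<in> A \<Longrightarrow> s *s z \<in> S"
  shows "(\<lambda>s. f (s *s z)) holomorphic_on A"
  unfolding holomorphic_on_def
  using holomorphic_fun_on_line[of f S 0 _ z] assms
  by (auto simp: field_differentiable_def intro: has_field_derivative_at_within)

section \<open>Maps that multiply a vector by a function\<close>

lemma has_derivative_scalar_multiple_nth:
  assumes f: "holomorphic_fun_on f S" and z: "z \<in> S"
  shows "((\<lambda>x. (f x *s x) $ i) has_derivative
      (\<lambda>h. f z * h $ i + frechet_derivative f (at z) h * z $ i)) (at z)"
  using has_derivative_mult[OF holomorphic_fun_on_frechet(1)[OF f z]
      bounded_linear_imp_has_derivative[OF bounded_linear_vec_nth]]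
  by (simp add: vector_smult_component)

lemma has_derivative_scalar_multiple:
  assumes f: "holomorphic_fun_on f S" and z: "z \<in> S"
  shows "((\<lambda>x. f x *s x) has_derivative (\<lambda>h. f z *s h + frechet_derivative f (at z) h *s z)) (at z)"
proof -
  have "((\<lambda>x. \<chi> i. (f x *s x) $ i) has_derivative
      (\<lambda>h. \<chi> i. f z * h $ i + frechet_derivative f (at z) h * z $ i)) (at z)"
    by (intro has_derivative_vec_lambda has_derivative_scalar_multiple_nth[OF f z])
  moreover have "(\<lambda>h. \<chi> i. f z * h $ i + frechet_derivative f (at z) h * z $ i)
      = (\<lambda>h. f z *s h + frechet_derivative f (at z) h *s z)"
    by (simp add: fun_eq_iff vec_eq_iff)
  ultimately show ?thesis by (simp only: vec_lambda_eta)
qed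

lemma holomorphic_fun_on_scalar_multiple_nth:
  assumes f: "holomorphic_fun_on f S"
  shows "holomorphic_fun_on (\<lambda>x. (f x *s x) $ i) S"
proof (rule holomorphic_fun_onI)
  show "open S" using f by (simp add: holomorphic_fun_on_def)
  fix z assume z: "z \<in> S"
  show "((\<lambda>x. (f x *s x) $ i) has_derivative
      (\<lambda>h. f z * h $ i + frechet_derivative f (at z) h * z $ i)) (at z)"
    by (rule has_derivative_scalar_multiple_nth[OF f z])
  show "f z * (c *s v) $ i + frechet_derivative f (at z) (c *s v) * z $ i
      = c * (f z * v $ i + frechet_derivative f (at z) v * z $ i)" for c v
    by (simp add: holomorphic_fun_on_frechet(2)[OF f z] algebra_simps)
qed

text \<open>Along the line through \<open>z\<close> the map is \<open>s \<mapsto> s h(s) z\<close> with \<open>h(s) = f(sz)\<close>; the factor \<open>s\<close> shifts the order by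
one.\<close>

lemma Dn_scalar_multiple_replicate:
  fixes f :: "complex^'n \<Rightarrow> complex"
  assumes f: "holomorphic_fun_on f S" and S: "0 \<in> S"
  shows "(1 / fact (Suc m)) *\<^sub>R Dn (\<lambda>x. f x *s x) (replicate (Suc m) z) 0
    = ((deriv ^^ m) (\<lambda>s. f (s *s z)) 0 / fact m) *s z"
proof -
  define h where "h = (\<lambda>s. f (s *s z))"
  have S': "open S" using f by (simp add: holomorphic_fun_on_def)
  have T: "open {s. s *s z \<in> S}" by (rule open_line_vimage[OF S'])
  have hol: "h holomorphic_on {s. s *s z \<in> S}"
    unfolding h_def by (rule holomorphic_on_line[OF f]) simp
  have H: "h has_fps_expansion fps_expansion h 0"
    by (rule has_fps_expansion_fps_expansion[OF T _ hol]) (simp add: S)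
  have nth: "(deriv ^^ Suc m) (\<lambda>s. (f (s *s z) *s (s *s z)) $ i) 0 / fact (Suc m)
      = (deriv ^^ m) h 0 / fact m * z $ i" for i
  proof -
    have "(\<lambda>s. z $ i * (s * h s)) has_fps_expansion fps_const (z $ i) * (fps_X * fps_expansion h 0)"
      by (intro fps_expansion_intros H)
    then have "fps_expansion (\<lambda>s. z $ i * (s * h s)) 0 = fps_const (z $ i) * (fps_X * fps_expansion h 0)"
      by (rule fps_expansion_eqI)
    then have "fps_nth (fps_expansion (\<lambda>s. z $ i * (s * h s)) 0) (Suc m)
        = z $ i * fps_nth (fps_expansion h 0) m"
      by simp
    then show ?thesis
      by (simp add: fps_expansion_def h_def mult_ac del: funpow.simps fact_Suc)
  qed
  have "Dn (\<lambda>x. f x *s x) (replicate (Suc m) z) 0 $ i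
      = (deriv ^^ Suc m) (\<lambda>s. (f (s *s z) *s (s *s z)) $ i) 0" for i
    using Dn_vec_nth[OF holomorphic_fun_on_scalar_multiple_nth[OF f] S]
      Dn_replicate_line[OF holomorphic_fun_on_scalar_multiple_nth[OF f], of 0 z]
    by (simp add: S del: replicate_Suc funpow.simps)
  then show ?thesis
    using nth by (simp add: vec_eq_iff scaleR_conv_of_real[where 'a = complex] h_def del: replicate_Suc funpow.simps fact_Suc)
qed

text \<open>The vector \<open>D\<^sup>3F(0)(z\<^sup>3)/3!\<close> inserted as last argument is the multiple \<open>h\<^sub>2 z\<close> of \<open>z\<close>, where
\<open>h(s) = f(sz)\<close>. The mixed derivative therefore reduces to a pure one, without polarisation.\<close>

lemma Dn_scalar_multiple_zalcman:
  fixes f :: "complex^'n \<Rightarrow> complex"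
  assumes f: "holomorphic_fun_on f S" and S: "0 \<in> S"
  defines "F \<equiv> \<lambda>x. f x *s x"
  shows "(1 / fact 3) *\<^sub>R Dn F [z, z, (1 / fact 3) *\<^sub>R Dn F [z, z, z] 0] 0
         - (1 / fact 5) *\<^sub>R Dn F [z, z, z, z, z] 0
    = (((deriv ^^ 2) (\<lambda>s. f (s *s z)) 0 / fact 2)\<^sup>2 - (deriv ^^ 4) (\<lambda>s. f (s *s z)) 0 / fact 4) *s z"
proof -
  define c where "c m = (deriv ^^ m) (\<lambda>s. f (s *s z)) 0 / fact m" for m
  have 3: "(1 / fact 3) *\<^sub>R Dn F [z, z, z] 0 = c 2 *s z"
    using Dn_scalar_multiple_replicate[OF f S, of 2 z]
    by (simp add: F_def c_def eval_nat_numeral del: fact_Suc funpow.simps Dn.simps)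
  have 5: "(1 / fact 5) *\<^sub>R Dn F [z, z, z, z, z] 0 = c 4 *s z"
    using Dn_scalar_multiple_replicate[OF f S, of 4 z]
    by (simp add: F_def c_def eval_nat_numeral del: fact_Suc funpow.simps Dn.simps)
  have Fi: "holomorphic_fun_on (\<lambda>x. F x $ i) S" for i
    unfolding F_def by (rule holomorphic_fun_on_scalar_multiple_nth[OF f])
  have "Dn F [z, z, c 2 *s z] 0 = c 2 *s Dn F [z, z, z] 0"
    using Dn_smult_last[OF Fi S, of _ "[z, z]" "c 2" z]
    by (simp add: vec_eq_iff Dn_vec_nth[OF Fi S] del: Dn.simps)
  then have "(1 / fact 3) *\<^sub>R Dn F [z, z, c 2 *s z] 0 = c 2 *s ((1 / fact 3) *\<^sub>R Dn F [z, z, z] 0)"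
    by (simp add: vec_eq_iff del: Dn.simps)
  then show ?thesis
    unfolding 3 5 c_def[symmetric] by (simp add: 3 vec_eq_iff power2_eq_square algebra_simps del: Dn.simps)
qed

section \<open>The maximum norm and the polydisk\<close>

lemma norm_nth_le_maxnorm: "cmod (z $ j) \<le> maxnorm z"
  unfolding maxnorm_def by (rule Max_ge) auto

lemma maxnorm_attained: "\<exists>k. cmod (z $ k) = maxnorm z"
proof -
  have "maxnorm z \<in> range (\<lambda>j. cmod (z $ j))"
    unfolding maxnorm_def by (rule Max_in) auto
  then show ?thesis by auto
qed

lemma maxnorm_less_iff: "maxnorm z < a \<longleftrightarrow> (\<forall>j. cmod (z $ j) < a)"
  unfolding maxnorm_def by (subst Max_less_iff) auto

lemma maxnorm_smult: "maxnorm (c *s z) = cmod c * maxnorm z"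
proof -
  have "maxnorm (c *s z) = Max ((\<lambda>x. cmod c * x) ` range (\<lambda>j. cmod (z $ j)))"
    by (simp add: maxnorm_def image_image norm_mult)
  also have "\<dots> = cmod c * Max (range (\<lambda>j. cmod (z $ j)))"
    by (rule mono_Max_commute[symmetric]) (auto intro!: monoI mult_left_mono)
  finally show ?thesis by (simp add: maxnorm_def)
qed

lemma maxnorm_eq_0_iff: "maxnorm z = 0 \<longleftrightarrow> z = 0"
proof
  assume "maxnorm z = 0"
  then have "cmod (z $ j) \<le> 0" for j using norm_nth_le_maxnorm[of z j] by simp
  then show "z = 0" by (simp add: vec_eq_iff)
qed (simp add: maxnorm_def)

lemma maxnorm_nonneg: "0 \<le> maxnorm z"
  using maxnorm_attained[of z] by (metis norm_ge_zero)

lemma open_polydisk: "open (polydisk :: (complex^'n) set)"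
proof -
  have eq: "polydisk = {z :: complex^'n. \<forall>i. z $ i \<in> ball 0 1}"
    by (auto simp: polydisk_def maxnorm_less_iff)
  show ?thesis unfolding eq by (rule open_vector_box) simp
qed

section \<open>Starlikeness on complex lines\<close>

text \<open>The line through \<open>z\<close> is invariant under the derivative, with eigenvalue \<open>d\<close>.\<close>

lemma inv_derivative_scalar_multiple:
  fixes f :: "complex^'n \<Rightarrow> complex"
  assumes f: "holomorphic_fun_on f S" and z: "z \<in> S" "z \<noteq> 0"
  defines "D \<equiv> frechet_derivative (\<lambda>x. f x *s x) (at z)"
    and "d \<equiv> f z + frechet_derivative f (at z) z"
  assumes bij: "bij D"
  shows "d \<noteq> 0" and "inv D (f z *s z) = (f z / d) *s z"
proof -
  have D: "D = (\<lambda>h. f z *s h + frechet_derivative f (at z) h *s z)"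
    unfolding D_def by (rule frechet_derivative_at[symmetric, OF has_derivative_scalar_multiple[OF f z(1)]])
  have Dz: "D (c *s z) = (c * d) *s z" for c
    by (simp add: D d_def holomorphic_fun_on_frechet(2)[OF f z(1)] vec_eq_iff algebra_simps)
  show d: "d \<noteq> 0"
  proof
    assume "d = 0"
    then have "D (1 *s z) = D (0 *s z)" by (simp only: Dz) simp
    then have "1 *s z = 0 *s z" using bij by (metis bij_is_inj injD)
    then show False using z(2) by simp
  qed
  have "D ((f z / d) *s z) = f z *s z" unfolding Dz using d by simp
  then show "inv D (f z *s z) = (f z / d) *s z"
    using bij by (metis bij_is_inj inv_f_f)
qed

text \<open>A kernel vector must be a multiple of \<open>z\<close>, on which the derivative acts by a nonzero scalar.\<close>

lemma bij_derivative_scalar_multiple: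
  fixes f :: "complex^'n \<Rightarrow> complex"
  assumes f: "holomorphic_fun_on f S" and z: "z \<in> S"
    and nz: "f z \<noteq> 0" "f z + frechet_derivative f (at z) z \<noteq> 0"
  shows "bij (frechet_derivative (\<lambda>x. f x *s x) (at z))"
proof -
  define D where "D = frechet_derivative (\<lambda>x. f x *s x) (at z)"
  let ?L = "frechet_derivative f (at z)"
  have D: "D = (\<lambda>h. f z *s h + ?L h *s z)"
    unfolding D_def by (rule frechet_derivative_at[symmetric, OF has_derivative_scalar_multiple[OF f z]])
  have lin: "linear D"
    unfolding D by (rule has_derivative_linear[OF has_derivative_scalar_multiple[OF f z]])
  have "h = 0" if "D h = 0" for h
  proof -
    define c where "c = - ?L h / f z"
    have comp: "f z * h $ i + ?L h * z $ i = 0" for i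
      using that by (simp add: D vec_eq_iff)
    have h: "h = c *s z"
    proof (rule vec_eq_iff[THEN iffD2], rule allI)
      fix i show "h $ i = (c *s z) $ i"
        using comp[of i] nz(1) by (simp add: c_def field_simps add_eq_0_iff)
    qed
    have "(c * (f z + ?L z)) *s z = D h"
      unfolding D by (simp add: h holomorphic_fun_on_frechet(2)[OF f z] vec_eq_iff algebra_simps)
    then have "(f z + ?L z) *s h = 0"
      using that by (simp add: h vec_eq_iff mult_ac)
    then show ?thesis using nz(2) by (metis vector_mul_eq_0)
  qed
  then have "inj D" using lin by (simp add: linear_injective_0)
  then show ?thesis
    using linear_inj_imp_surj[OF lin] by (simp add: bij_def D_def)
qed

lemma starlike_quotient_positive:
  fixes f :: "complex^'n \<Rightarrow> complex"
  assumes f: "holomorphic_fun_on f polydisk" and F: "(\<lambda>x. f x *s x) \<in> starlike_maps"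
    and z: "z \<in> polydisk" "z \<noteq> 0"
  shows "0 < Re (f z / (f z + frechet_derivative f (at z) z))"
proof -
  obtain k where k: "cmod (z $ k) = maxnorm z" using maxnorm_attained by blast
  have zk: "z $ k \<noteq> 0" using k z(2) by (metis maxnorm_eq_0_iff norm_zero)
  have "bij (frechet_derivative (\<lambda>x. f x *s x) (at z))"
    using F z by (simp add: starlike_maps_def locally_biholomorphic_def)
  from inv_derivative_scalar_multiple(2)[OF f z this]
  have "inv (frechet_derivative (\<lambda>x. f x *s x) (at z)) (f z *s z) $ k / z $ k
      = f z / (f z + frechet_derivative f (at z) z)"
    using zk by simp
  moreover have "0 < Re (inv (frechet_derivative (\<lambda>x. f x *s x) (at z)) (f z *s z) $ k / z $ k)"
    using F z k unfolding starlike_maps_def by blast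
  ultimately show ?thesis by simp
qed

lemma norm_Cayley_less_1:
  assumes "0 < Re q"
  shows "1 + q \<noteq> 0" "cmod ((1 - q) / (1 + q)) < 1"
proof -
  have "Re (1 + q) \<noteq> 0" using assms by simp
  then show ne: "1 + q \<noteq> 0" by (metis zero_complex.sel(1))
  have "(cmod (1 - q))\<^sup>2 < (cmod (1 + q))\<^sup>2"
    using assms unfolding cmod_power2 by (simp add: power2_eq_square algebra_simps)
  then have "cmod (1 - q) < cmod (1 + q)" by (rule power2_less_imp_less) simp
  then show "cmod ((1 - q) / (1 + q)) < 1" using ne by (simp add: norm_divide divide_simps)
qed

text \<open>The differential equation is the definition of \<open>p\<close> solved for \<open>h'\<close>. Positivity of the real part enters
twice: it keeps the denominator of \<open>p\<close> away from \<open>0\<close>, and through the Cayley transform it gives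
\<open>\<bar>s p(s)\<bar> < 1\<close>.\<close>

lemma starlike_slice_zalcman_bound:
  fixes f :: "complex^'n \<Rightarrow> complex"
  assumes f: "holomorphic_fun_on f polydisk" and f0: "f 0 = 1"
    and F: "(\<lambda>x. f x *s x) \<in> starlike_maps" and u: "maxnorm u = 1"
  defines "h \<equiv> \<lambda>s. f (s *s u)"
  shows "cmod (((deriv ^^ 2) h 0 / fact 2)\<^sup>2 - (deriv ^^ 4) h 0 / fact 4) \<le> 4"
proof -
  have disk: "s *s u \<in> polydisk" if "s \<in> ball 0 1" for s
    using that u by (simp add: polydisk_def maxnorm_smult)
  have holh: "h holomorphic_on ball 0 1"
    unfolding h_def by (rule holomorphic_on_line[OF f disk])
  have dh: "deriv h s = frechet_derivative f (at (s *s u)) u" if "s \<in> ball 0 1" for s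
    unfolding h_def using holomorphic_fun_on_line[OF f, of 0 s u] disk[OF that]
    by (simp add: DERIV_imp_deriv)
  have pos: "0 < Re (h s / (h s + s * deriv h s))" if s: "s \<in> ball 0 1" "s \<noteq> 0" for s
  proof -
    have "s *s u \<noteq> 0" using s(2) u maxnorm_eq_0_iff[of "s *s u"] by (simp add: maxnorm_smult)
    from starlike_quotient_positive[OF f F disk[OF s(1)] this]
    show ?thesis
      using holomorphic_fun_on_frechet(2)[OF f disk[OF s(1)]] dh[OF s(1)] by (simp add: h_def)
  qed
  have h0: "h 0 = 1" by (simp add: h_def f0)
  define p where "p = (\<lambda>s. deriv h s / (2 * h s + s * deriv h s))"
  have p: "2 * h s + s * deriv h s \<noteq> 0" "cmod (s * p s) < 1" if s: "s \<in> ball 0 1" for s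
  proof -
    have "2 * h s + s * deriv h s \<noteq> 0 \<and> cmod (s * p s) < 1"
    proof (cases "s = 0")
      case True
      then show ?thesis by (simp add: h0)
    next
      case False
      define d q where "d = h s + s * deriv h s" and "q = h s / d"
      have q: "0 < Re q" using pos[OF s False] by (simp add: q_def d_def)
      then have "d \<noteq> 0" by (auto simp: q_def)
      then have hs: "h s = q * d" by (simp add: q_def)
      have sum: "2 * h s + s * deriv h s = (1 + q) * d" "s * deriv h s = (1 - q) * d"
        using hs by (simp_all add: d_def algebra_simps)
      have "s * p s = (1 - q) / (1 + q)"
        using \<open>d \<noteq> 0\<close> unfolding p_def times_divide_eq_right sum(1) unfolding sum(2) by simp
      then show ?thesis using norm_Cayley_less_1[OF q] \<open>d \<noteq> 0\<close> sum by simp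
    qed
    then show "2 * h s + s * deriv h s \<noteq> 0" "cmod (s * p s) < 1" by auto
  qed
  have holp: "p holomorphic_on ball 0 1"
    unfolding p_def using p(1) by (intro holomorphic_intros holh) auto
  have bound: "cmod (p s) \<le> 1" if s: "s \<in> ball 0 1" for s
  proof -
    have hol: "(\<lambda>s. s * p s) holomorphic_on ball 0 1" by (intro holomorphic_intros holp)
    have lt: "cmod (s * p s) < 1" if "norm s < 1" for s using p(2)[of s] that by simp
    show ?thesis
    proof (cases "s = 0")
      case True
      \<comment> \<open>Dividing by \<open>s\<close> is impossible here; the derivative half of the Schwarz lemma takes over.\<close>
      have "(p has_field_derivative deriv p 0) (at 0)"
        using holp by (rule holomorphic_derivI) auto
      then have "((\<lambda>s. s * p s) has_field_derivative p 0) (at 0)"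
        by (auto intro!: derivative_eq_intros)
      then show ?thesis
        using Schwarz_Lemma(2)[OF hol _ lt, of 0] True by (simp add: DERIV_imp_deriv)
    next
      case False
      then show ?thesis
        using Schwarz_Lemma(1)[OF hol _ lt, of s] s by (simp add: norm_mult)
    qed
  qed
  show ?thesis
    by (rule zalcman_functional_bound[OF holh holp h0 bound]) (use p(1) in \<open>simp_all add: p_def\<close>)
qed

text \<open>The functional is homogeneous of degree four in \<open>z\<close>, so the bound on the unit sphere scales.\<close>

lemma starlike_zalcman_inequality:
  fixes f :: "complex^'n \<Rightarrow> complex"
  assumes f: "holomorphic_fun_on f polydisk" and f0: "f 0 = 1"
    and F: "(\<lambda>x. f x *s x) \<in> starlike_maps" and z: "z \<in> polydisk"
  defines "h \<equiv> \<lambda>s. f (s *s z)"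
  shows "cmod (((deriv ^^ 2) h 0 / fact 2)\<^sup>2 - (deriv ^^ 4) h 0 / fact 4) \<le> 4 * maxnorm z ^ 4"
proof (cases "z = 0")
  case True
  then have "h = (\<lambda>s. 1)" by (simp add: h_def f0)
  then show ?thesis using maxnorm_nonneg[of z] by (simp add: higher_deriv_const)
next
  case False
  define r where "r = maxnorm z"
  have r: "0 < r" "r < 1"
    using False z maxnorm_nonneg[of z] maxnorm_eq_0_iff[of z] by (auto simp: r_def polydisk_def)
  define u where "u = of_real (1 / r) *s z"
  have u: "maxnorm u = 1" using r by (simp add: u_def maxnorm_smult r_def[symmetric] norm_divide)
  have z_eq: "s *s z = (of_real r * s) *s u" for s
    using r by (simp add: u_def vec_eq_iff)
  define g where "g = (\<lambda>s. f (s *s u))"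
  have holg: "g holomorphic_on ball 0 1"
    unfolding g_def by (rule holomorphic_on_line[OF f]) (simp add: polydisk_def maxnorm_smult u)
  have scale: "(deriv ^^ m) h 0 = of_real r ^ m * (deriv ^^ m) g 0" for m
  proof -
    have "(deriv ^^ m) (\<lambda>s. g (of_real r * s)) 0 = of_real r ^ m * (deriv ^^ m) g (of_real r * 0)"
      by (rule higher_deriv_compose_linear[OF holg, of "ball 0 1"])
        (use r in \<open>auto simp: norm_mult intro: le_less_trans[OF mult_left_le_one_le]\<close>)
    then show ?thesis by (simp add: h_def g_def z_eq)
  qed
  have "((deriv ^^ 2) h 0 / fact 2)\<^sup>2 - (deriv ^^ 4) h 0 / fact 4
      = of_real r ^ 4 * (((deriv ^^ 2) g 0 / fact 2)\<^sup>2 - (deriv ^^ 4) g 0 / fact 4)"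
    unfolding scale by (simp add: power_divide power_mult_distrib power_mult[symmetric] algebra_simps)
  then have "cmod (((deriv ^^ 2) h 0 / fact 2)\<^sup>2 - (deriv ^^ 4) h 0 / fact 4)
      = r ^ 4 * cmod (((deriv ^^ 2) g 0 / fact 2)\<^sup>2 - (deriv ^^ 4) g 0 / fact 4)"
    using r by (simp add: norm_mult norm_power)
  also have "\<dots> \<le> r ^ 4 * 4"
    unfolding g_def using r by (intro mult_left_mono starlike_slice_zalcman_bound[OF f f0 F u]) auto
  finally show ?thesis by (simp add: r_def mult.commute)
qed

section \<open>The Koebe map\<close>

text \<open>On the \<open>k\<close>-th coordinate axis \<open>koebe_factor k z *s z\<close> is the Koebe function \<open>w/(1 - w)\<^sup>2\<close>.\<close>

definition koebe_factor :: "'n \<Rightarrow> complex^'n \<Rightarrow> complex" where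
  "koebe_factor k z = 1 / (1 - z $ k)\<^sup>2"

lemma polydisk_nth_neq: "z \<in> polydisk \<Longrightarrow> 1 - z $ k \<noteq> 0" "z \<in> polydisk \<Longrightarrow> 1 + z $ k \<noteq> 0"
  using norm_nth_le_maxnorm[of z k]
  by (auto simp: polydisk_def add_eq_0_iff)

lemma has_derivative_koebe_factor:
  assumes "z \<in> polydisk"
  shows "(koebe_factor k has_derivative (\<lambda>h. 2 / (1 - z $ k) ^ 3 * h $ k)) (at z)"
proof -
  have ne: "1 - z $ k \<noteq> 0" by (rule polydisk_nth_neq(1)[OF assms])
  have "2 * (1 - z $ k) / ((1 - z $ k)\<^sup>2 * (1 - z $ k)\<^sup>2) = 2 / (1 - z $ k) ^ 3"
    using ne by (simp add: divide_simps eval_nat_numeral)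
  then have "((\<lambda>w. 1 / (1 - w)\<^sup>2) has_field_derivative 2 / (1 - z $ k) ^ 3) (at (z $ k))"
    using ne by (auto intro!: derivative_eq_intros)
  then have "((\<lambda>w. 1 / (1 - w)\<^sup>2) has_derivative (*) (2 / (1 - z $ k) ^ 3)) (at (z $ k))"
    by (simp add: has_field_derivative_def)
  from has_derivative_compose[OF bounded_linear_imp_has_derivative[OF bounded_linear_vec_nth] this]
  show ?thesis by (simp add: koebe_factor_def[abs_def])
qed

lemma holomorphic_koebe_factor: "holomorphic_fun_on (koebe_factor k) polydisk"
  by (rule holomorphic_fun_onI[OF open_polydisk has_derivative_koebe_factor]) auto

lemma koebe_factor_radial:
  assumes z: "z \<in> polydisk"
  shows "koebe_factor k z + frechet_derivative (koebe_factor k) (at z) z = (1 + z $ k) / (1 - z $ k) ^ 3"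
proof -
  define a where "a = 1 - z $ k"
  have a: "a \<noteq> 0" "z $ k = 1 - a" using polydisk_nth_neq(1)[OF z, of k] by (simp_all add: a_def)
  have "frechet_derivative (koebe_factor k) (at z) z = 2 / a ^ 3 * (1 - a)"
    by (simp add: frechet_derivative_at[OF has_derivative_koebe_factor[OF z], symmetric] a_def)
  moreover have "koebe_factor k z = 1 / a\<^sup>2"
    by (simp add: koebe_factor_def a_def)
  ultimately show ?thesis
    unfolding a(2) using a(1) by (simp add: field_simps power2_eq_square power3_eq_cube)
qed

lemma koebe_starlike: "(\<lambda>z. koebe_factor k z *s z) \<in> starlike_maps"
proof -
  let ?f = "koebe_factor k" and ?F = "\<lambda>z. koebe_factor k z *s z"
  note hol = holomorphic_koebe_factor[of k]
  have nz: "?f z \<noteq> 0" "?f z + frechet_derivative ?f (at z) z \<noteq> 0" if "z \<in> polydisk" for z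
    unfolding koebe_factor_radial[OF that] using polydisk_nth_neq[OF that, of k]
    by (simp_all add: koebe_factor_def)
  have bij: "bij (frechet_derivative ?F (at z))" if "z \<in> polydisk" for z
    by (rule bij_derivative_scalar_multiple[OF hol that nz[OF that]])
  have zero: "0 \<in> polydisk" by (simp add: polydisk_def maxnorm_eq_0_iff[THEN iffD2])
  have "holomorphic_map_on ?F polydisk"
    unfolding holomorphic_map_on_def
  proof (intro conjI ballI open_polydisk)
    fix z :: "complex^'a" assume z: "z \<in> polydisk"
    show "\<exists>L. (?F has_derivative L) (at z) \<and> Vector_Spaces.linear (*s) (*s) L"
      using has_derivative_scalar_multiple[OF hol z] holomorphic_fun_on_frechet[OF hol z]
        linear_add[OF has_derivative_linear[OF holomorphic_fun_on_frechet(1)[OF hol z]]]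
      by (intro exI conjI) (auto simp: clinear_vec_iff vec_eq_iff algebra_simps)
  qed
  moreover have "normalized ?F"
    using frechet_derivative_at[OF has_derivative_scalar_multiple[OF hol zero], symmetric]
    by (simp add: normalized_def koebe_factor_def fun_eq_iff)
  moreover have "0 < Re (inv (frechet_derivative ?F (at z)) (?F z) $ j / z $ j)"
    if z: "z \<in> polydisk" "z \<noteq> 0" and j: "cmod (z $ j) = maxnorm z" for z j
  proof -
    have zj: "z $ j \<noteq> 0" using j z(2) by (metis maxnorm_eq_0_iff norm_zero)
    define w where "w = z $ k"
    have w: "cmod w < 1" using norm_nth_le_maxnorm[of z k] z(1) by (simp add: w_def polydisk_def)
    have ne: "1 - w \<noteq> 0" "1 + w \<noteq> 0" using polydisk_nth_neq[OF z(1), of k] by (simp_all add: w_def)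
    have "inv (frechet_derivative ?F (at z)) (?F z) $ j / z $ j
        = ?f z / (?f z + frechet_derivative ?f (at z) z)"
      unfolding inv_derivative_scalar_multiple(2)[OF hol z bij[OF z(1)]] using zj by simp
    also have "\<dots> = (1 - w) / (1 + w)"
    proof -
      have "1 / a\<^sup>2 / (b / a ^ 3) = a / b" if "a \<noteq> 0" "b \<noteq> 0" for a b :: complex
        using that by (simp add: power2_eq_square power3_eq_cube)
      from this[OF ne] show ?thesis
        unfolding koebe_factor_radial[OF z(1)] by (simp add: koebe_factor_def w_def)
    qed
    also have "0 < Re ((1 - w) / (1 + w))"
    proof -
      have "(cmod w)\<^sup>2 < 1" using w by (simp add: power_less_one_iff abs_square_less_1)
      then have "0 < Re ((1 - w) * cnj (1 + w))"
        unfolding cmod_power2 by (simp add: power2_eq_square algebra_simps)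
      then show ?thesis using ne(2) by (simp add: Re_complex_div_gt_0)
    qed
    finally show ?thesis .
  qed
  ultimately show ?thesis
    using bij by (auto simp: starlike_maps_def locally_biholomorphic_def)
qed

lemma koebe_zalcman_value:
  fixes k :: "'n::finite"
  defines "h \<equiv> \<lambda>s. koebe_factor k (s *s (\<chi> i. 1 / 2))"
  shows "((deriv ^^ 2) h 0 / fact 2)\<^sup>2 - (deriv ^^ 4) h 0 / fact 4 = 1 / 4"
proof -
  have h: "h = (\<lambda>s. 1 / (1 - s / 2)\<^sup>2)" by (simp add: h_def koebe_factor_def)
  have ne: "1 - s / 2 \<noteq> 0" if "s \<in> ball 0 1" for s :: complex
    using that by (auto simp: field_simps)
  have dh: "(h has_field_derivative 1 / (1 - s / 2) ^ 3) (at s)" if "s \<in> ball 0 1" for s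
    unfolding h using ne[OF that]
    by (auto intro!: derivative_eq_intros simp: divide_simps power2_eq_square eval_nat_numeral)
  have hol: "h holomorphic_on ball 0 1"
    unfolding h using ne by (intro holomorphic_intros) auto
  \<comment> \<open>Along this vector the quotient \<open>h'/(2h + s h')\<close> is the constant \<open>1/2\<close>.\<close>
  have const: "(\<lambda>_. 1 / 2 :: complex) has_fps_expansion fps_const (1 / 2)"
    by simp
  have "((deriv ^^ 2) h 0 / fact 2)\<^sup>2 - (deriv ^^ 4) h 0 / fact 4 = 4 * (1 / 2) ^ 4 - 0 - 0 - 0"
  proof (subst zalcman_functional_eq[OF hol const])
    fix s :: complex assume s: "s \<in> ball 0 1"
    define a where "a = 1 - s / 2"
    have "a \<noteq> 0" using ne[OF s] by (simp add: a_def)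
    have "s = 2 * (1 - a)" by (simp add: a_def)
    have dhs: "deriv h s = 1 / a ^ 3" using dh[OF s] by (simp add: DERIV_imp_deriv a_def)
    have hs: "h s = 1 / a\<^sup>2" by (simp add: h a_def)
    show "deriv h s = 1 / 2 * (2 * h s + s * deriv h s)"
      unfolding dhs hs unfolding \<open>s = 2 * (1 - a)\<close>
      using \<open>a \<noteq> 0\<close> by (simp add: field_simps power2_eq_square power3_eq_cube)
  qed (simp_all add: h)
  then show ?thesis by (simp add: power4_eq_xxxx)
qed

theorem theorem3:
  shows "(\<forall>f :: complex^'n \<Rightarrow> complex.
            holomorphic_fun_on f polydisk \<longrightarrow> f 0 = 1 \<longrightarrow>
            (let F = (\<lambda>z. f z *s z) in
               F \<in> starlike_maps \<longrightarrow>
               (\<forall>z\<in>polydisk.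
                  maxnorm ((1 / fact 3) *\<^sub>R Dn F [z, z, (1 / fact 3) *\<^sub>R Dn F [z, z, z] 0] 0
                           - (1 / fact 5) *\<^sub>R Dn F [z, z, z, z, z] 0)
                  \<le> 4 * maxnorm z ^ 5)))
       \<and> (\<exists>f :: complex^'n \<Rightarrow> complex.
            holomorphic_fun_on f polydisk \<and> f 0 = 1 \<and>
            (let F = (\<lambda>z. f z *s z) in
               F \<in> starlike_maps \<and>
               (\<exists>z\<in>polydisk - {0}.
                  maxnorm ((1 / fact 3) *\<^sub>R Dn F [z, z, (1 / fact 3) *\<^sub>R Dn F [z, z, z] 0] 0
                           - (1 / fact 5) *\<^sub>R Dn F [z, z, z, z, z] 0)
                  = 4 * maxnorm z ^ 5)))"
proof (intro conjI allI impI)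
  have zero: "0 \<in> (polydisk :: (complex^'n) set)"
    by (simp add: polydisk_def maxnorm_eq_0_iff[THEN iffD2])
  note Dn = Dn_scalar_multiple_zalcman[OF _ zero]
  {
    fix f :: "complex^'n \<Rightarrow> complex"
    assume f: "holomorphic_fun_on f polydisk" and f0: "f 0 = 1"
    show "let F = (\<lambda>z. f z *s z) in F \<in> starlike_maps \<longrightarrow>
        (\<forall>z\<in>polydisk.
           maxnorm ((1 / fact 3) *\<^sub>R Dn F [z, z, (1 / fact 3) *\<^sub>R Dn F [z, z, z] 0] 0
                    - (1 / fact 5) *\<^sub>R Dn F [z, z, z, z, z] 0) \<le> 4 * maxnorm z ^ 5)"
      unfolding Let_def Dn[OF f] maxnorm_smult
    proof (intro impI ballI)
      fix z :: "complex^'n"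
      assume F: "(\<lambda>z. f z *s z) \<in> starlike_maps" and z: "z \<in> polydisk"
      have "4 * maxnorm z ^ 5 = 4 * maxnorm z ^ 4 * maxnorm z"
        by (simp add: eval_nat_numeral)
      then show "cmod (((deriv ^^ 2) (\<lambda>s. f (s *s z)) 0 / fact 2)\<^sup>2
          - (deriv ^^ 4) (\<lambda>s. f (s *s z)) 0 / fact 4) * maxnorm z \<le> 4 * maxnorm z ^ 5"
        using starlike_zalcman_inequality[OF f f0 F z] maxnorm_nonneg[of z]
        by (metis mult_right_mono)
    qed
  }
  define k :: 'n where "k = undefined"
  define z :: "complex^'n" where "z = (\<chi> i. 1 / 2)"
  have z: "maxnorm z = 1 / 2" by (simp add: z_def maxnorm_def)
  show "\<exists>f :: complex^'n \<Rightarrow> complex. holomorphic_fun_on f polydisk \<and> f 0 = 1 \<and>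
      (let F = (\<lambda>z. f z *s z) in F \<in> starlike_maps \<and>
         (\<exists>z\<in>polydisk - {0}.
            maxnorm ((1 / fact 3) *\<^sub>R Dn F [z, z, (1 / fact 3) *\<^sub>R Dn F [z, z, z] 0] 0
                     - (1 / fact 5) *\<^sub>R Dn F [z, z, z, z, z] 0) = 4 * maxnorm z ^ 5))"
    unfolding Let_def
  proof (intro exI[of _ "koebe_factor k"] conjI bexI[of _ z])
    show "maxnorm ((1 / fact 3) *\<^sub>R Dn (\<lambda>z. koebe_factor k z *s z)
              [z, z, (1 / fact 3) *\<^sub>R Dn (\<lambda>z. koebe_factor k z *s z) [z, z, z] 0] 0
            - (1 / fact 5) *\<^sub>R Dn (\<lambda>z. koebe_factor k z *s z) [z, z, z, z, z] 0) = 4 * maxnorm z ^ 5"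
      unfolding Dn[OF holomorphic_koebe_factor] maxnorm_smult z
      unfolding z_def koebe_zalcman_value by (simp add: norm_divide eval_nat_numeral)
    show "z \<in> polydisk - {0}"
      using z maxnorm_eq_0_iff[of z] by (auto simp: polydisk_def)
  qed (simp_all add: holomorphic_koebe_factor koebe_starlike, simp add: koebe_factor_def)
qed

end
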